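(* Let $(\mathbf H,\mathbf g,m)$ be a triplet consisting of a sub-stochastic matrix $\mathbf H=(h_{ij})_{i,j\ge1}$, a probability distribution $\mathbf g=(g_1,g_2,\ldots)$ on $\{1,2,\ldots\}$, and a constant $m>0$. Let $\{\mathbf Z^{(n)}\}_{n\ge0}$ be the linear-fractional multi-type Bienaym\'e-Galton-Watson process with parameters $(\mathbf H,\mathbf g,m)$, and let $\mathbf M=\mathbf H+m\mathbf H\mathbf 1^{\mathrm t}\mathbf g$ be its matrix of mean offspring numbers. Then for every $n\ge1$ there are a sub-stochastic matrix $\mathbf H^{(n)}$ with rows $\mathbf h_i^{(n)}$ ($i\ge1$), a probability distribution $\mathbf g^{(n)}$ on $\{1,2,\ldots\}$ and a constant $m^{(n)}>0$ such that, for every $i\ge1$, if the process starts from a single particle of type $i$, then the $n$-th generation size vector $\mathbf Z^{(n)}$ has the linear-fractional distribution $\mathrm{LF}(\mathbf h_i^{(n)},\mathbf g^{(n)},m^{(n)})$, where the parameters satisfy $$m^{(n)}=m\sum_{k=0}^{n-1}\mathbf g\mathbf M^k\mathbf 1^{\mathrm t},$$ $$m^{(n)}\mathbf g^{(n)}=m\,\mathbf g(\mathbf I+\mathbf M+\dots+\mathbf M^{n-1}),$$ $$\mathbf H^{(n)}=\mathbf M^n-\frac{m^{(n)}}{1+m^{(n)}}\mathbf M^n\mathbf 1^{\mathrm t}\mathbf g^{(n)}.$$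
   Context: Vectors are row vectors indexed by $\{1,2,\ldots\}$; $\mathbf x^{\mathrm t}$ denotes the transpose; $\mathbf 1=(1,1,\ldots)$; $\mathbf 0=(0,0,\ldots)$; $\mathbf e_i$ is the $i$-th unit vector; $\mathbf I=(1_{\{i=j\}})_{i,j\ge1}$ and $\mathbf M^0=\mathbf I$; $\mathbf s^{\mathbf x}=s_1^{x_1}s_2^{x_2}\cdots$. A sub-stochastic matrix is a matrix with non-negative entries and all row sums at most $1$; put $h_{i0}=1-\sum_{j\ge1}h_{ij}\in[0,1]$. Linear-fractional distribution: let $(h_0,h_1,h_2,\ldots)$ be a probability distribution on $\{0,1,2,\ldots\}$, $\mathbf h=(h_1,h_2,\ldots)$, $\mathbf g=(g_1,g_2,\ldots)$ a probability distribution on $\{1,2,\ldots\}$ and $m>0$. A random vector $\mathbf Z$ with non-negative integer components and finite sum has distribution $\mathrm{LF}(\mathbf h,\mathbf g,m)$ if its generating function is $$\mathbb E(\mathbf s^{\mathbf Z})=h_0+\frac{\sum_{i\ge1}h_is_i}{1+m-m\sum_{i\ge1}g_is_i},\qquad \mathbf s\in[0,1]^{\infty}.$$ Multi-type Bienaym\'e-Galton-Watson (BGW) process with types $1,2,\ldots$: each particle lives one unit of time and at death produces a random number of new particles of various types, independently of all other particles, with law depending only on its own type. $\mathbf Z^{(n)}=(Z_1^{(n)},Z_2^{(n)},\ldots)$, where $Z_j^{(n)}$ is the number of type $j$ particles at time $n$. The process is called linear-fractional with parameters $(\mathbf H,\mathbf g,m)$ if, for each $i\ge1$, the offspring vector of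 a type $i$ particle has distribution $\mathrm{LF}(\mathbf h_i,\mathbf g,m)$, where $\mathbf h_i=(h_{i1},h_{i2},\ldots)$ is the $i$-th row of $\mathbf H$. The mean matrix has entries $m_{ij}=\mathbb E(Z_j^{(1)}\mid\mathbf Z^{(0)}=\mathbf e_i)$. *)

theory Defs
  imports "HOL-Probability.Probability"
begin

text \<open>
  The index set $\{1,2,\ldots\}$ of particle types is relabelled as the type \<^typ>\<open>nat\<close>
  (type $i$ becomes $i-1$), so vectors and matrices are indexed from $0$. The mass $h_{i0}$ at the
  zero vector has no index of its own and is written as one minus the row sum.
  All series used for the parameters have non-negative terms and converge, so real-valued
  \<^const>\<open>suminf\<close> is the intended sum.
\<close>

type_synonym rvec = "nat \<Rightarrow> real"
type_synonym rmat = "nat \<Rightarrow> nat \<Rightarrow> real"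

definition ones :: rvec where
  "ones = (\<lambda>_. 1)"

definition scalar_prod :: "rvec \<Rightarrow> rvec \<Rightarrow> real" where
  "scalar_prod v w = (\<Sum>j. v j * w j)"

definition vec_mat :: "rvec \<Rightarrow> rmat \<Rightarrow> rvec" where
  "vec_mat v A = (\<lambda>j. \<Sum>i. v i * A i j)"

definition mat_vec :: "rmat \<Rightarrow> rvec \<Rightarrow> rvec" where
  "mat_vec A v = (\<lambda>i. \<Sum>j. A i j * v j)"

definition mat_mult :: "rmat \<Rightarrow> rmat \<Rightarrow> rmat" where
  "mat_mult A B = (\<lambda>i j. \<Sum>k. A i k * B k j)"

definition id_mat :: rmat where
  "id_mat = (\<lambda>i j. if i = j then 1 else 0)"

primrec mat_pow :: "rmat \<Rightarrow> nat \<Rightarrow> rmat" where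
  "mat_pow A 0 = id_mat"
| "mat_pow A (Suc n) = mat_mult (mat_pow A n) A"

definition subprob_vec :: "rvec \<Rightarrow> bool" where
  "subprob_vec h \<longleftrightarrow> (\<forall>j. 0 \<le> h j) \<and> summable h \<and> (\<Sum>j. h j) \<le> 1"

definition prob_vec :: "rvec \<Rightarrow> bool" where
  "prob_vec g \<longleftrightarrow> (\<forall>j. 0 \<le> g j) \<and> g sums 1"

definition substochastic :: "rmat \<Rightarrow> bool" where
  "substochastic H \<longleftrightarrow> (\<forall>i. subprob_vec (H i))"

definition unit_vec :: "nat \<Rightarrow> nat \<Rightarrow> nat" where
  "unit_vec i = (\<lambda>j. if j = i then 1 else 0)"

abbreviation count_vec_algebra :: "(nat \<Rightarrow> nat) measure" where
  "count_vec_algebra \<equiv> (\<Pi>\<^sub>M j\<in>UNIV. count_space UNIV)"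

definition finite_supp :: "(nat \<Rightarrow> nat) \<Rightarrow> bool" where
  "finite_supp x \<longleftrightarrow> finite {j. x j \<noteq> 0}"

text \<open>The monomial $\mathbf s^{\mathbf x}$; the factors outside the support of $x$ are all $1$.\<close>

definition monomial :: "rvec \<Rightarrow> (nat \<Rightarrow> nat) \<Rightarrow> real" where
  "monomial s x = (\<Prod>j | x j \<noteq> 0. s j ^ x j)"

definition has_LF_distribution ::
  "'w measure \<Rightarrow> ('w \<Rightarrow> nat \<Rightarrow> nat) \<Rightarrow> rvec \<Rightarrow> rvec \<Rightarrow> real \<Rightarrow> bool" where
  "has_LF_distribution P X h g m \<longleftrightarrow>
     subprob_vec h \<and> prob_vec g \<and> 0 < m \<and>
     X \<in> P \<rightarrow>\<^sub>M count_vec_algebra \<and> (\<forall>\<omega>\<in>space P. finite_supp (X \<omega>)) \<and>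
     (\<forall>s. (\<forall>j. 0 \<le> s j \<and> s j \<le> 1) \<longrightarrow>
        (\<integral>\<omega>. monomial s (X \<omega>) \<partial>P) =
          (1 - (\<Sum>j. h j)) + (\<Sum>j. h j * s j) / (1 + m - m * (\<Sum>j. g j * s j)))"

text \<open>
  \<open>\<xi> n i k\<close> is the offspring vector of the \<open>k\<close>-th particle of type \<open>i\<close> in generation \<open>n\<close>, and
  \<open>z\<close> is the deterministic initial population.
\<close>

locale bgw_process = prob_space P
  for P :: "'w measure" +
  fixes z :: "nat \<Rightarrow> nat"
    and \<xi> :: "nat \<Rightarrow> nat \<Rightarrow> nat \<Rightarrow> 'w \<Rightarrow> nat \<Rightarrow> nat"
    and Z :: "nat \<Rightarrow> 'w \<Rightarrow> nat \<Rightarrow> nat"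
  assumes finite_init: "finite_supp z"
    and finite_offspring: "\<And>n i k \<omega>. \<omega> \<in> space P \<Longrightarrow> finite_supp (\<xi> n i k \<omega>)"
    and indep_offspring:
      "indep_vars (\<lambda>_. count_vec_algebra) (\<lambda>(n, i, k). \<xi> n i k) UNIV"
    and law_by_type:
      "\<And>n i k. distr P count_vec_algebra (\<xi> n i k) = distr P count_vec_algebra (\<xi> 0 i 0)"
    and init: "\<And>\<omega>. \<omega> \<in> space P \<Longrightarrow> Z 0 \<omega> = z"
    and generation: "\<And>n \<omega> j. \<omega> \<in> space P \<Longrightarrow>
      Z (Suc n) \<omega> j = (\<Sum>i | Z n \<omega> i \<noteq> 0. \<Sum>k<Z n \<omega> i. \<xi> n i k \<omega> j)"

locale lf_bgw_process = bgw_process P z \<xi> Z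
  for P :: "'w measure" and z \<xi> Z +
  fixes H :: rmat and g :: rvec and m :: real
  assumes offspring_LF: "\<And>n i k. has_LF_distribution P (\<xi> n i k) (H i) g m"

definition lf_mean_matrix :: "rmat \<Rightarrow> rvec \<Rightarrow> real \<Rightarrow> rmat" where
  "lf_mean_matrix H g m = (\<lambda>i j. H i j + m * mat_vec H ones i * g j)"

end

(* Write f for the vector of offspring generating functions. Conditioning on generation n shows
   that E(s^Z^(n+1)) = E(f(s)^Z^(n)), so the generating function of Z^(n) is the n-th iterate of f.
   With w = m g, a linear-fractional generating function is 1 - h.1 + h.s / (1 + w.1 - w.s), and
   substituting f into it gives a function of the same form, because the numerator and the
   denominator become affine in s over the common factor 1 + m - m g.s. The new w is m g + w M, and
   the mean h + (h.1) w of the new law is the old mean times M. Starting from h = e_i and w = 0 at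
   n = 0, this gives w_n = m g (I + M + ... + M^(n-1)) and M^n = h_n + (h_n.1) w_n, from which h_n is
   recovered. The mean matrix itself is obtained from the difference quotient of the generating
   function at s = 1 by monotone convergence. *)

theory Submission imports Defs begin

subsection \<open>Non-negative summable vectors\<close>

definition l1pos :: "rvec \<Rightarrow> bool" where
  "l1pos v \<longleftrightarrow> (\<forall>j. 0 \<le> v j) \<and> summable v"

text \<open>The uniform bound on the row sums lets \<open>A\<close> map summable row vectors to
  summable ones and bounded columns to bounded ones, so that every series in a matrix product
  converges.\<close>

definition bdd_rows :: "real \<Rightarrow> rmat \<Rightarrow> bool" where
  "bdd_rows B A \<longleftrightarrow> (\<forall>i. l1pos (A i) \<and> scalar_prod (A i) ones \<le> B)"

lemma l1pos_nonneg: "l1pos v \<Longrightarrow> 0 \<le> v j"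
  by (simp add: l1pos_def)

lemma l1pos_summable: "l1pos v \<Longrightarrow> summable v"
  by (simp add: l1pos_def)

lemma l1pos_add_scaled:
  "\<lbrakk>l1pos v; l1pos w; 0 \<le> a; 0 \<le> b\<rbrakk> \<Longrightarrow> l1pos (\<lambda>j. a * v j + b * w j)"
  by (auto simp: l1pos_def intro!: summable_add summable_mult)

lemma l1pos_mult_bounded:
  assumes "l1pos v" "\<forall>j. 0 \<le> s j \<and> s j \<le> C"
  shows "l1pos (\<lambda>j. v j * s j)"
  unfolding l1pos_def
proof (intro conjI allI)
  show "summable (\<lambda>j. v j * s j)"
  proof (rule summable_comparison_test')
    show "summable (\<lambda>j. v j * C)"
      using assms(1) by (auto simp: l1pos_def intro: summable_mult2)
    show "norm (v j * s j) \<le> v j * C" if "0 \<le> j" for j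
      using assms by (auto simp: l1pos_def abs_mult intro!: mult_mono)
  qed
qed (use assms in \<open>auto simp: l1pos_def\<close>)

lemma ones_bounds: "\<forall>j. 0 \<le> ones j \<and> ones j \<le> 1"
  by (simp add: ones_def)

lemma scalar_prod_ones: "scalar_prod v ones = suminf v"
  by (simp add: scalar_prod_def ones_def)

lemma scalar_prod_add_scaled:
  assumes "l1pos v" "l1pos w" "\<forall>j. 0 \<le> s j \<and> s j \<le> C"
  shows "scalar_prod (\<lambda>j. a * v j + b * w j) s = a * scalar_prod v s + b * scalar_prod w s"
proof -
  have "summable (\<lambda>j. v j * s j)" "summable (\<lambda>j. w j * s j)"
    using assms l1pos_mult_bounded l1pos_summable by blast+
  then have "(\<lambda>j. a * (v j * s j) + b * (w j * s j)) sums (a * scalar_prod v s + b * scalar_prod w s)"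
    unfolding scalar_prod_def by (intro sums_add sums_mult) (auto simp: summable_sums)
  then show ?thesis
    unfolding scalar_prod_def by (simp add: algebra_simps sums_iff)
qed

lemma scalar_prod_nonneg:
  assumes "l1pos v" "\<forall>j. 0 \<le> s j \<and> s j \<le> C"
  shows "0 \<le> scalar_prod v s"
  using l1pos_mult_bounded[OF assms] unfolding l1pos_def scalar_prod_def
  by (auto intro: suminf_nonneg)

lemma scalar_prod_le:
  assumes "l1pos v" "\<forall>j. 0 \<le> s j \<and> s j \<le> C"
  shows "scalar_prod v s \<le> C * scalar_prod v ones"
proof -
  have "scalar_prod v s \<le> (\<Sum>j. C * v j)"
    unfolding scalar_prod_def
  proof (rule suminf_le)
    show "v j * s j \<le> C * v j" for j
      using assms by (metis l1pos_nonneg mult.commute mult_left_mono)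
  qed (use assms in \<open>auto intro!: summable_mult l1pos_summable l1pos_mult_bounded\<close>)
  then show ?thesis
    using assms(1) by (simp add: suminf_mult l1pos_summable scalar_prod_ones)
qed

lemma summable_nonneg_has_sum:
  fixes f :: "nat \<Rightarrow> real"
  assumes "\<And>i. 0 \<le> f i" "summable f"
  shows "(f has_sum suminf f) UNIV"
  using assms by (intro sums_nonneg_imp_has_sum summable_sums)

text \<open>Tonelli for double series: non-negativity turns the iterated sum into an unordered sum
  over \<open>UNIV \<times> UNIV\<close>, which is then read back in the other order.\<close>

lemma sums_swap_nonneg:
  fixes f :: "nat \<Rightarrow> nat \<Rightarrow> real"
  assumes nonneg: "\<And>i j. 0 \<le> f i j"
    and rows: "\<And>i. summable (f i)" and total: "summable (\<lambda>i. \<Sum>j. f i j)"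
  shows "summable (\<lambda>i. f i j)" and "(\<lambda>j. \<Sum>i. f i j) sums (\<Sum>i. \<Sum>j. f i j)"
proof -
  let ?S = "\<Sum>i. \<Sum>j. f i j"
  have r: "(f i has_sum (\<Sum>j. f i j)) UNIV" for i
    by (rule summable_nonneg_has_sum[OF nonneg rows])
  have t: "((\<lambda>i. \<Sum>j. f i j) has_sum ?S) UNIV"
    by (rule summable_nonneg_has_sum[OF suminf_nonneg[OF rows nonneg] total])
  have "(case_prod f) summable_on (UNIV \<times> UNIV)"
    using r has_sum_imp_summable[OF t] nonneg
    by (intro summable_on_SigmaI[where g = "\<lambda>i. \<Sum>j. f i j"]) auto
  then have "(case_prod f has_sum ?S) (UNIV \<times> UNIV)"
    using r t by (intro has_sum_SigmaI[where g = "\<lambda>i. \<Sum>j. f i j"]) auto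
  then have sw: "((\<lambda>(j, i). f i j) has_sum ?S) (UNIV \<times> UNIV)"
    using has_sum_swap[where f = "case_prod f" and S = ?S and A = UNIV and B = UNIV] by simp
  then have "(\<lambda>(j, i). f i j) summable_on (UNIV \<times> UNIV)"
    by (rule has_sum_imp_summable)
  then have c: "(\<lambda>i. f i j) summable_on UNIV" for j
    by (rule summable_on_SigmaD1[where f = "\<lambda>j i. f i j" and B = "\<lambda>_. UNIV"]) simp
  then show "summable (\<lambda>i. f i j)"
    by (rule summable_on_imp_summable)
  have "((\<lambda>i. f i j) has_sum (\<Sum>i. f i j)) UNIV" for j
    by (rule summable_nonneg_has_sum[OF nonneg summable_on_imp_summable[OF c]])
  then have "((\<lambda>j. \<Sum>i. f i j) has_sum ?S) UNIV"
    by (intro has_sum_SigmaD[OF sw]) auto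
  then show "(\<lambda>j. \<Sum>i. f i j) sums ?S"
    by (rule has_sum_imp_sums)
qed

section \<open>Matrices with bounded row sums\<close>

context
  fixes A :: rmat and B :: real
  assumes A: "bdd_rows B A"
begin

lemma bdd_rows_row: "l1pos (A i)" "scalar_prod (A i) ones \<le> B"
  using A by (auto simp: bdd_rows_def)

lemma mat_vec_bounds:
  assumes "\<forall>j. 0 \<le> s j \<and> s j \<le> C" "0 \<le> C"
  shows "\<forall>i. 0 \<le> mat_vec A s i \<and> mat_vec A s i \<le> C * B"
proof
  fix i
  have eq: "mat_vec A s i = scalar_prod (A i) s"
    by (simp add: mat_vec_def scalar_prod_def)
  have "mat_vec A s i \<le> C * scalar_prod (A i) ones"
    using scalar_prod_le[OF _ assms(1)] bdd_rows_row eq by simp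
  also have "\<dots> \<le> C * B"
    using bdd_rows_row assms(2) by (intro mult_left_mono) auto
  finally show "0 \<le> mat_vec A s i \<and> mat_vec A s i \<le> C * B"
    using scalar_prod_nonneg[OF _ assms(1)] bdd_rows_row eq by simp
qed

end

context
  fixes A :: rmat and v :: rvec and B :: real
  assumes A: "bdd_rows B A" and v: "l1pos v"
begin

text \<open>\<open>sums_swap_nonneg\<close> for the array \<open>v i * A i j * s j\<close>: its row
  sums \<open>v i * mat_vec A s i\<close> are summable because \<open>mat_vec A s\<close> is
  bounded. Taking \<open>s = ones\<close> gives convergence of \<open>vec_mat v A\<close>; a general
  \<open>s\<close> gives the adjoint rule \<open>scalar_prod_vec_mat\<close>.\<close>

lemma vec_mat_aux:
  assumes "\<forall>j. 0 \<le> s j \<and> s j \<le> C" "0 \<le> C"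
  shows "summable (\<lambda>i. v i * A i j * s j)"
    and "(\<lambda>j. \<Sum>i. v i * A i j * s j) sums scalar_prod v (mat_vec A s)"
proof -
  have row: "summable (\<lambda>j. A i j * s j)" for i
    using l1pos_mult_bounded[OF _ assms(1)] bdd_rows_row[OF A] by (simp add: l1pos_summable)
  then have row_eq: "(\<Sum>j. v i * A i j * s j) = v i * mat_vec A s i" for i
    by (simp add: mult.assoc suminf_mult mat_vec_def)
  have n: "0 \<le> v i * A i j * s j" for i j
    using v bdd_rows_row[OF A] assms by (simp add: l1pos_nonneg)
  have r: "summable (\<lambda>j. v i * A i j * s j)" for i
    using row[of i] by (simp add: mult.assoc summable_mult)
  have t: "summable (\<lambda>i. \<Sum>j. v i * A i j * s j)"
    unfolding row_eq using l1pos_summable[OF l1pos_mult_bounded[OF v mat_vec_bounds[OF A assms]]] .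
  show "summable (\<lambda>i. v i * A i j * s j)"
    using sums_swap_nonneg(1)[OF n r t] .
  show "(\<lambda>j. \<Sum>i. v i * A i j * s j) sums scalar_prod v (mat_vec A s)"
    using sums_swap_nonneg(2)[OF n r t] by (simp add: row_eq scalar_prod_def)
qed

lemma vec_mat_summable: "summable (\<lambda>i. v i * A i j)"
  using vec_mat_aux(1)[of ones 1] by (simp add: ones_def)

lemma l1pos_vec_mat: "l1pos (vec_mat v A)"
  using vec_mat_aux(2)[of ones 1] vec_mat_summable v bdd_rows_row[OF A]
  by (auto simp: l1pos_def ones_def vec_mat_def sums_iff intro: suminf_nonneg)

lemma scalar_prod_vec_mat:
  assumes "\<forall>j. 0 \<le> s j \<and> s j \<le> C" "0 \<le> C"
  shows "scalar_prod (vec_mat v A) s = scalar_prod v (mat_vec A s)"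
proof -
  have "(\<Sum>i. v i * A i j * s j) = vec_mat v A j * s j" for j
    using vec_mat_summable by (simp add: vec_mat_def suminf_mult2)
  then show ?thesis
    using vec_mat_aux(2)[OF assms] unfolding scalar_prod_def by (simp add: sums_iff)
qed

lemma scalar_prod_vec_mat_ones:
  "scalar_prod (vec_mat v A) ones = scalar_prod v (mat_vec A ones)"
  by (rule scalar_prod_vec_mat[where C = 1]) (auto simp: ones_def)

text \<open>An entry of \<open>N\<close> is at most its row sum, so the columns of \<open>N\<close>
  are bounded vectors and \<open>scalar_prod_vec_mat\<close> applies to them one at a time.\<close>

lemma vec_mat_assoc:
  assumes "bdd_rows C N"
  shows "vec_mat (vec_mat v A) N = vec_mat v (mat_mult A N)"
proof
  fix j
  have "0 \<le> N i j \<and> N i j \<le> C" for i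
  proof -
    have "l1pos (N i)" "suminf (N i) \<le> C"
      using assms by (auto simp: bdd_rows_def scalar_prod_ones)
    moreover from this have "N i j \<le> suminf (N i)"
      using sum_le_suminf[of "N i" "{j}"] by (auto simp: l1pos_def)
    ultimately show ?thesis by (auto simp: l1pos_def)
  qed
  then have "scalar_prod (vec_mat v A) (\<lambda>i. N i j) = scalar_prod v (mat_vec A (\<lambda>i. N i j))"
    by (intro scalar_prod_vec_mat[where C = C]) (auto intro: order_trans)
  then show "vec_mat (vec_mat v A) N j = vec_mat v (mat_mult A N) j"
    by (simp add: scalar_prod_def vec_mat_def mat_mult_def mat_vec_def)
qed

end

lemma vec_mat_add_scaled:
  assumes "bdd_rows B A" "l1pos v" "l1pos w"
  shows "vec_mat (\<lambda>j. a * v j + b * w j) A j = a * vec_mat v A j + b * vec_mat w A j"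
proof -
  have "(\<lambda>i. a * (v i * A i j) + b * (w i * A i j)) sums (a * vec_mat v A j + b * vec_mat w A j)"
    unfolding vec_mat_def using vec_mat_summable assms
    by (intro sums_add sums_mult) (auto simp: summable_sums)
  then show ?thesis
    unfolding vec_mat_def by (simp add: algebra_simps sums_iff)
qed

lemma l1pos_unit: "l1pos (\<lambda>j. if i = j then 1 else 0)"
  and scalar_prod_unit: "scalar_prod (\<lambda>j. if i = j then 1 else 0) s = s i"
proof -
  have *: "(\<lambda>j. (if i = j then 1 else 0) * s j) sums s i" for s :: rvec
    using sums_single[of i s] by (simp add: if_distrib[of "\<lambda>x. x * _"] eq_commute cong: if_cong)
  show "l1pos (\<lambda>j. if i = j then 1 else 0)"
    using *[of ones] by (auto simp: l1pos_def ones_def sums_iff)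
  show "scalar_prod (\<lambda>j. if i = j then 1 else 0) s = s i"
    using *[of s] by (simp add: scalar_prod_def sums_iff)
qed

lemma mat_pow_Suc_row: "mat_pow A (Suc n) i = vec_mat (mat_pow A n i) A"
  by (simp add: mat_mult_def vec_mat_def)

text \<open>The row sums of the next power are the current power applied to the row sums of
  \<open>A\<close>, which lie between 0 and \<open>B\<close>.\<close>

lemma bdd_rows_mat_pow:
  assumes "bdd_rows B A" "0 \<le> B"
  shows "bdd_rows (B ^ n) (mat_pow A n)"
proof (induction n)
  case 0
  show ?case
    using l1pos_unit scalar_prod_unit by (simp add: bdd_rows_def id_mat_def ones_def)
next
  case (Suc n)
  have "l1pos (mat_pow A (Suc n) i) \<and> scalar_prod (mat_pow A (Suc n) i) ones \<le> B ^ Suc n" for i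
  proof -
    have row: "l1pos (mat_pow A n i)" "scalar_prod (mat_pow A n i) ones \<le> B ^ n"
      using Suc by (auto simp: bdd_rows_def)
    have "\<forall>k. 0 \<le> mat_vec A ones k \<and> mat_vec A ones k \<le> B"
      using mat_vec_bounds[OF assms(1) ones_bounds] by simp
    then have "scalar_prod (mat_pow A n i) (mat_vec A ones) \<le> B * scalar_prod (mat_pow A n i) ones"
      by (intro scalar_prod_le row)
    also have "\<dots> \<le> B ^ Suc n"
      using row assms(2) by (simp add: mult_left_mono)
    finally show ?thesis
      unfolding mat_pow_Suc_row
      using l1pos_vec_mat[OF assms(1) row(1)] scalar_prod_vec_mat_ones[OF assms(1) row(1)] by simp
  qed
  then show ?case by (simp add: bdd_rows_def)
qed

lemma subprob_vec_iff_l1pos: "subprob_vec v \<longleftrightarrow> l1pos v \<and> scalar_prod v ones \<le> 1"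
  by (auto simp: subprob_vec_def l1pos_def scalar_prod_ones)

lemma prob_vec_iff_l1pos: "prob_vec v \<longleftrightarrow> l1pos v \<and> scalar_prod v ones = 1"
  by (auto simp: prob_vec_def l1pos_def scalar_prod_ones sums_iff)

lemma scalar_prod_scaled:
  assumes "l1pos v" "\<forall>j. 0 \<le> s j \<and> s j \<le> C"
  shows "scalar_prod (\<lambda>j. a * v j) s = a * scalar_prod v s"
  using scalar_prod_add_scaled[OF assms(1) assms(1) assms(2), of a 0] by simp

lemma l1pos_scaled: "\<lbrakk>l1pos v; 0 \<le> a\<rbrakk> \<Longrightarrow> l1pos (\<lambda>j. a * v j)"
  using l1pos_add_scaled[of v v a 0] by simp

lemma vec_mat_scaled:
  assumes "bdd_rows B A" "l1pos v"
  shows "vec_mat (\<lambda>j. a * v j) A = (\<lambda>j. a * vec_mat v A j)"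
  using vec_mat_add_scaled[OF assms assms(2), of a 0] by auto

lemma vec_mat_sum:
  assumes "\<And>k. k \<in> K \<Longrightarrow> bdd_rows (B k) (A k)" "l1pos v"
  shows "vec_mat v (\<lambda>i j. \<Sum>k\<in>K. A k i j) j = (\<Sum>k\<in>K. vec_mat v (A k) j)"
proof -
  have "(\<lambda>i. \<Sum>k\<in>K. v i * A k i j) sums (\<Sum>k\<in>K. vec_mat v (A k) j)"
    unfolding vec_mat_def using vec_mat_summable assms
    by (intro sums_sum summable_sums) blast
  then show ?thesis
    unfolding vec_mat_def by (simp add: sum_distrib_left sums_iff)
qed

lemma vec_mat_sum_left:
  assumes "finite K" "bdd_rows B A" "\<And>k. k \<in> K \<Longrightarrow> l1pos (v k)"
  shows "vec_mat (\<lambda>j. \<Sum>k\<in>K. v k j) A j = (\<Sum>k\<in>K. vec_mat (v k) A j)"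
proof -
  have "(\<lambda>i. \<Sum>k\<in>K. v k i * A i j) sums (\<Sum>k\<in>K. vec_mat (v k) A j)"
    unfolding vec_mat_def using vec_mat_summable assms
    by (intro sums_sum summable_sums) blast
  then show ?thesis
    unfolding vec_mat_def by (simp add: sum_distrib_right sums_iff)
qed

lemma scalar_prod_sum_left:
  assumes "\<And>k. k \<in> K \<Longrightarrow> l1pos (v k)"
  shows "scalar_prod (\<lambda>j. \<Sum>k\<in>K. v k j) ones = (\<Sum>k\<in>K. scalar_prod (v k) ones)"
proof -
  have "(\<lambda>j. \<Sum>k\<in>K. v k j) sums (\<Sum>k\<in>K. suminf (v k))"
    using assms by (intro sums_sum summable_sums l1pos_summable)
  then show ?thesis
    by (simp add: scalar_prod_ones sums_iff)
qed

lemma vec_mat_id: "vec_mat v id_mat = v"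
proof
  fix j
  have "(\<lambda>i. v i * id_mat i j) = (\<lambda>i. if i = j then v i else 0)"
    by (auto simp: id_mat_def)
  then show "vec_mat v id_mat j = v j"
    using sums_single[of j v] by (simp add: vec_mat_def sums_iff)
qed

subsection \<open>Composition of linear-fractional generating functions\<close>

text \<open>
  The vector \<open>w\<close> stands for $m\mathbf g$; unlike the pair $(m, \mathbf g)$ it also covers generation
  $0$, where \<open>w = 0\<close>.
\<close>

definition lf_gf :: "rvec \<Rightarrow> rvec \<Rightarrow> rvec \<Rightarrow> real" where
  "lf_gf h w s = 1 - scalar_prod h ones +
     scalar_prod h s / (1 + scalar_prod w ones - scalar_prod w s)"

text \<open>The gradient of \<open>lf_gf h w\<close> at \<open>ones\<close>.\<close>

definition lf_mean :: "rvec \<Rightarrow> rvec \<Rightarrow> rvec" where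
  "lf_mean h w = (\<lambda>j. h j + scalar_prod h ones * w j)"

lemma lf_mean_total:
  assumes "l1pos h" "l1pos w"
  shows "scalar_prod (lf_mean h w) ones = scalar_prod h ones * (1 + scalar_prod w ones)"
  using scalar_prod_add_scaled[OF assms ones_bounds, of 1 "scalar_prod h ones"]
  by (simp add: lf_mean_def algebra_simps)

text \<open>As \<open>g\<close> has mass 1, the scaled vector has mass \<open>m\<close>. This is the
  passage between \<open>lf_gf\<close> and the form used in
  \<open>has_LF_distribution\<close>.\<close>

lemma lf_gf_scaled:
  assumes "prob_vec g" "\<forall>j. 0 \<le> s j \<and> s j \<le> 1"
  shows "lf_gf h (\<lambda>j. m * g j) s = (1 - (\<Sum>j. h j)) + (\<Sum>j. h j * s j) / (1 + m - m * (\<Sum>j. g j * s j))"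
  using assms
  by (simp add: lf_gf_def scalar_prod_scaled[OF _ assms(2)] scalar_prod_scaled[OF _ ones_bounds] prob_vec_iff_l1pos)
     (simp add: scalar_prod_def ones_def)

section \<open>The effect of one generation on the parameters\<close>

locale lf_offspring =
  fixes H :: rmat and w0 :: rvec
  assumes H: "bdd_rows 1 H" and w0: "l1pos w0"
begin

definition mean_mat :: rmat where
  "mean_mat = (\<lambda>i. lf_mean (H i) w0)"

text \<open>By \<open>scalar_prod_vec_mat_ones\<close> this is the total mass of
  \<open>vec_mat v H\<close>; \<open>lost_mass\<close> is the part of \<open>v\<close> that falls on
  the row defects of \<open>H\<close>.\<close>

abbreviation image_mass :: "rvec \<Rightarrow> real" where
  "image_mass v \<equiv> scalar_prod v (mat_vec H ones)"

abbreviation lost_mass :: "rvec \<Rightarrow> real" where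
  "lost_mass v \<equiv> scalar_prod v ones - image_mass v"

text \<open>
  The parameters after one more generation, read off from the numerator and the denominator of the
  composed generating function.
\<close>

definition next_h :: "rvec \<Rightarrow> rvec \<Rightarrow> rvec" where
  "next_h h w = (\<lambda>j. vec_mat h H j + lost_mass h / (1 + image_mass w) * vec_mat w H j)"

definition next_w :: "rvec \<Rightarrow> rvec" where
  "next_w w = (\<lambda>j. (1 + image_mass w) * w0 j + vec_mat w H j)"

lemma Hs_bounds:
  assumes "\<forall>j. 0 \<le> s j \<and> s j \<le> 1"
  shows "\<forall>i. 0 \<le> mat_vec H s i \<and> mat_vec H s i \<le> 1"
  using mat_vec_bounds[OF H assms] by auto

lemma bdd_rows_mean_mat: "bdd_rows (1 + scalar_prod w0 ones) mean_mat"
proof -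
  have "l1pos (mean_mat i) \<and> scalar_prod (mean_mat i) ones \<le> 1 + scalar_prod w0 ones" for i
  proof -
    have Hi: "l1pos (H i)" "scalar_prod (H i) ones \<le> 1"
      using H by (auto simp: bdd_rows_def)
    have 0: "0 \<le> scalar_prod (H i) ones" "0 \<le> scalar_prod w0 ones"
      using scalar_prod_nonneg[where C = 1] Hi w0 ones_bounds by blast+
    have "mean_mat i = (\<lambda>j. 1 * H i j + scalar_prod (H i) ones * w0 j)"
      by (simp add: mean_mat_def lf_mean_def)
    then have "l1pos (mean_mat i)" and "scalar_prod (mean_mat i) ones
        = scalar_prod (H i) ones + scalar_prod (H i) ones * scalar_prod w0 ones"
      using l1pos_add_scaled[OF Hi(1) w0, of 1 "scalar_prod (H i) ones"]
        scalar_prod_add_scaled[OF Hi(1) w0 ones_bounds, of 1 "scalar_prod (H i) ones"] 0 by auto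
    moreover have "scalar_prod (H i) ones * scalar_prod w0 ones \<le> scalar_prod w0 ones"
      using Hi 0 by (simp add: mult_left_le_one_le)
    ultimately show ?thesis using Hi by simp
  qed
  then show ?thesis by (simp add: bdd_rows_def)
qed

text \<open>The mean matrix is \<open>H\<close> plus the rank-one matrix with entries
  \<open>mat_vec H ones i * w0 j\<close>.\<close>

lemma vec_mat_mean_mat:
  assumes "l1pos v"
  shows "vec_mat v mean_mat j = vec_mat v H j + scalar_prod v (mat_vec H ones) * w0 j"
proof -
  have "summable (\<lambda>i. v i * H i j)" "summable (\<lambda>i. v i * mat_vec H ones i)"
    using vec_mat_summable[OF H assms] l1pos_mult_bounded[OF assms Hs_bounds[OF ones_bounds]]
    by (auto simp: l1pos_summable)
  then have "(\<lambda>i. v i * H i j + v i * mat_vec H ones i * w0 j) sums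
      (vec_mat v H j + scalar_prod v (mat_vec H ones) * w0 j)"
    unfolding vec_mat_def scalar_prod_def
    by (intro sums_add sums_mult2) (auto simp: summable_sums)
  moreover have "v i * mean_mat i j = v i * H i j + v i * mat_vec H ones i * w0 j" for i
    by (simp add: mean_mat_def lf_mean_def mat_vec_def scalar_prod_def algebra_simps)
  ultimately show ?thesis by (simp add: vec_mat_def sums_iff)
qed

text \<open>The rank-one part of \<open>mean_mat\<close> absorbs the \<open>image_mass\<close> term,
  leaving an affine recursion that a geometric sum solves.\<close>

lemma next_w_eq:
  assumes "l1pos w"
  shows "next_w w j = w0 j + vec_mat w mean_mat j"
  using vec_mat_mean_mat[OF assms] by (simp add: next_w_def algebra_simps)

context
  fixes h w :: rvec
  assumes h: "l1pos h" "scalar_prod h ones \<le> 1" and w: "l1pos w"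
begin

lemma mass_nonneg: "0 \<le> lost_mass h" "0 \<le> image_mass w" "0 \<le> scalar_prod h ones"
  using scalar_prod_le[OF h(1) Hs_bounds[OF ones_bounds]]
    scalar_prod_nonneg[OF w Hs_bounds[OF ones_bounds]]
    scalar_prod_nonneg[OF h(1) ones_bounds] by auto

lemma l1pos_next_w: "l1pos (next_w w)"
  using l1pos_add_scaled[OF w0 l1pos_vec_mat[OF H w], of "1 + image_mass w" 1] mass_nonneg
  by (simp add: next_w_def)

lemma l1pos_next_h: "l1pos (next_h h w)"
  using l1pos_add_scaled[OF l1pos_vec_mat[OF H h(1)] l1pos_vec_mat[OF H w], of 1 "lost_mass h / (1 + image_mass w)"] mass_nonneg
  by (simp add: next_h_def)

lemma scalar_prod_next:
  assumes "\<forall>j. 0 \<le> s j \<and> s j \<le> 1"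
  shows "scalar_prod (next_w w) s = (1 + image_mass w) * scalar_prod w0 s + scalar_prod w (mat_vec H s)"
    and "scalar_prod (next_h h w) s = scalar_prod h (mat_vec H s) + lost_mass h / (1 + image_mass w) * scalar_prod w (mat_vec H s)"
  using scalar_prod_add_scaled[OF w0 l1pos_vec_mat[OF H w] assms, of "1 + image_mass w" 1]
    scalar_prod_add_scaled[OF l1pos_vec_mat[OF H h(1)] l1pos_vec_mat[OF H w] assms, of 1 "lost_mass h / (1 + image_mass w)"]
    scalar_prod_vec_mat[OF H w assms zero_le_one] scalar_prod_vec_mat[OF H h(1) assms zero_le_one]
  by (simp_all add: next_w_def next_h_def)

text \<open>With L the lost mass of \<open>h\<close> and W the image mass of \<open>w\<close>, the
  first summand of \<open>next_h\<close> loses L and the second gives back L W/(1+W), a net loss of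
  L/(1+W).\<close>

lemma next_h_total: "scalar_prod (next_h h w) ones = scalar_prod h ones - lost_mass h / (1 + image_mass w)"
  using scalar_prod_next(2)[OF ones_bounds] mass_nonneg by (simp add: field_simps)

lemma next_h_total_le: "scalar_prod (next_h h w) ones \<le> 1"
proof -
  have "0 \<le> lost_mass h / (1 + image_mass w)"
    using mass_nonneg by (intro divide_nonneg_nonneg) auto
  then show ?thesis using next_h_total h by linarith
qed

text \<open>The chain rule at \<open>ones\<close>: gradients of composed generating functions
  multiply. It is verified from the explicit parameters, without differentiation.\<close>

lemma lf_mean_next: "lf_mean (next_h h w) (next_w w) = vec_mat (lf_mean h w) mean_mat"
proof
  fix j
  have mean: "lf_mean h w = (\<lambda>j. 1 * h j + scalar_prod h ones * w j)"
    by (simp add: lf_mean_def)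
  define q where "q = lost_mass h / (1 + image_mass w)"
  have q: "(1 + image_mass w) * q = lost_mass h"
    using mass_nonneg by (simp add: q_def)
  have "lf_mean (next_h h w) (next_w w) j
      = vec_mat h H j + q * vec_mat w H j
        + (scalar_prod h ones - q) * ((1 + image_mass w) * w0 j + vec_mat w H j)"
    by (simp only: lf_mean_def next_h_total) (simp only: next_h_def next_w_def q_def)
  \<comment> \<open>The two \<open>q\<close> multiples of \<open>vec_mat w H j\<close> cancel. The
    coefficient of \<open>w0 j\<close> becomes
    \<open>scalar_prod h ones * image_mass w + image_mass h\<close>, exactly the rank-one
    contribution of \<open>mean_mat\<close>.\<close>
  also have "\<dots> = vec_mat h H j + scalar_prod h ones * vec_mat w H j
        + (scalar_prod h ones * (1 + image_mass w) - (1 + image_mass w) * q) * w0 j"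
    by (simp add: algebra_simps)
  also have "\<dots> = vec_mat h mean_mat j + scalar_prod h ones * vec_mat w mean_mat j"
    unfolding q vec_mat_mean_mat[OF w] vec_mat_mean_mat[OF h(1)] by (simp add: algebra_simps)
  also have "\<dots> = vec_mat (lf_mean h w) mean_mat j"
    unfolding mean using vec_mat_add_scaled[OF bdd_rows_mean_mat h(1) w, of 1 "scalar_prod h ones" j] by simp
  finally show "lf_mean (next_h h w) (next_w w) j = vec_mat (lf_mean h w) mean_mat j" .
qed

text \<open>All offspring types share \<open>w0\<close> and hence the denominator \<open>D\<close>.
  Both scalar products in the outer function are therefore affine in \<open>mat_vec H s\<close> over
  \<open>D\<close>, and \<open>D\<close> cancels from the quotient.\<close>

lemma lf_gf_compose:
  assumes s: "\<forall>j. 0 \<le> s j \<and> s j \<le> 1"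
  shows "lf_gf h w (\<lambda>i. lf_gf (H i) w0 s) = lf_gf (next_h h w) (next_w w) s"
proof -
  define D where "D = 1 + scalar_prod w0 ones - scalar_prod w0 s"
  have D: "D \<ge> 1"
    using scalar_prod_le[OF w0 s] by (simp add: D_def)
  have f: "(\<lambda>i. lf_gf (H i) w0 s) = (\<lambda>i. ones i - mat_vec H ones i + mat_vec H s i / D)"
    by (simp add: lf_gf_def D_def mat_vec_def scalar_prod_def ones_def)
  have sp: "scalar_prod v (\<lambda>i. lf_gf (H i) w0 s)
      = scalar_prod v ones - scalar_prod v (mat_vec H ones) + scalar_prod v (mat_vec H s) / D"
    if v: "l1pos v" for v
  proof -
    have 1: "summable (\<lambda>i. v i * ones i)" "summable (\<lambda>i. v i * mat_vec H ones i)"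
      "summable (\<lambda>i. v i * mat_vec H s i)"
      using l1pos_mult_bounded[OF v] Hs_bounds s ones_bounds by (blast intro: l1pos_summable)+
    have "(\<lambda>i. v i * ones i - v i * mat_vec H ones i + v i * mat_vec H s i / D) sums
       (scalar_prod v ones - scalar_prod v (mat_vec H ones) + scalar_prod v (mat_vec H s) / D)"
      unfolding scalar_prod_def using 1
      by (intro sums_add sums_diff sums_divide summable_sums)
    then show ?thesis
      unfolding f by (simp add: scalar_prod_def algebra_simps sums_iff)
  qed
  define K where "K = 1 + scalar_prod (next_w w) ones - scalar_prod (next_w w) s"
  have K: "K \<ge> 1"
    using scalar_prod_le[OF l1pos_next_w s] by (simp add: K_def)
  \<comment> \<open>This identity is what dictates the form of \<open>next_w\<close>.\<close>
  have K_eq: "K = (1 + image_mass w) * D - scalar_prod w (mat_vec H s)"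
    by (simp add: K_def D_def scalar_prod_next(1) s ones_bounds algebra_simps)
  have den: "1 + scalar_prod w ones - scalar_prod w (\<lambda>i. lf_gf (H i) w0 s) = K / D"
    unfolding sp[OF w] K_eq using D by (simp add: field_simps)
  have pos: "1 + image_mass w > 0" using mass_nonneg by simp
  have "lf_gf h w (\<lambda>i. lf_gf (H i) w0 s) = 1 - scalar_prod h ones + (lost_mass h * D + scalar_prod h (mat_vec H s)) / K"
    unfolding lf_gf_def[of h] den sp[OF h(1)] using D K by (simp add: field_simps)
  \<comment> \<open>Solving \<open>K_eq\<close> for \<open>D\<close> splits
    \<open>lost_mass h * D\<close> into a multiple of \<open>K\<close> and a multiple of
    \<open>scalar_prod w (mat_vec H s)\<close>. After division by \<open>K\<close> the former is
    constant and joins the mass at zero, while the latter belongs to \<open>next_h\<close>.\<close>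
  also have "lost_mass h * D + scalar_prod h (mat_vec H s) = lost_mass h / (1 + image_mass w) * K + scalar_prod (next_h h w) s"
    unfolding K_eq scalar_prod_next(2)[OF s] right_diff_distrib mult.assoc[symmetric]
    using pos by simp
  also have "1 - scalar_prod h ones + (lost_mass h / (1 + image_mass w) * K + scalar_prod (next_h h w) s) / K
      = lf_gf (next_h h w) (next_w w) s"
    unfolding lf_gf_def next_h_total K_def[symmetric] using K by (simp add: add_divide_distrib)
  finally show ?thesis .
qed

end

section \<open>Parameters of the n-th generation\<close>

definition cum_w :: "nat \<Rightarrow> rvec" where
  "cum_w n = (\<lambda>j. \<Sum>k<n. vec_mat w0 (mat_pow mean_mat k) j)"

lemma bdd_rows_mean_mat_pow: "bdd_rows ((1 + scalar_prod w0 ones) ^ k) (mat_pow mean_mat k)"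
  using scalar_prod_nonneg[OF w0 ones_bounds] by (intro bdd_rows_mat_pow bdd_rows_mean_mat) simp

lemma l1pos_cum_w: "l1pos (cum_w n)"
  using l1pos_vec_mat[OF bdd_rows_mean_mat_pow w0]
  by (auto simp: cum_w_def l1pos_def intro!: sum_nonneg summable_sum)

text \<open>Multiplication by \<open>mean_mat\<close> raises every exponent of the geometric sum by
  one, and the summand \<open>w0\<close> in \<open>next_w_eq\<close> restores the exponent
  0.\<close>

lemma cum_w_Suc: "cum_w (Suc n) = next_w (cum_w n)"
proof
  fix j
  have "vec_mat (cum_w n) mean_mat j = (\<Sum>k<n. vec_mat (vec_mat w0 (mat_pow mean_mat k)) mean_mat j)"
    unfolding cum_w_def
    by (rule vec_mat_sum_left[OF finite_lessThan bdd_rows_mean_mat l1pos_vec_mat[OF bdd_rows_mean_mat_pow w0]])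
  also have "\<dots> = (\<Sum>k<n. vec_mat w0 (mat_pow mean_mat (Suc k)) j)"
    by (simp add: vec_mat_assoc[OF bdd_rows_mean_mat_pow w0 bdd_rows_mean_mat])
  finally show "cum_w (Suc n) j = next_w (cum_w n) j"
    unfolding next_w_eq[OF l1pos_cum_w] by (simp only: cum_w_def[of "Suc n"] sum.lessThan_Suc_shift mat_pow.simps(1) vec_mat_id)
qed

text \<open>The recursive form makes non-negativity evident, which the closed form in
  \<open>h_seq_eq\<close>, being a difference, does not.\<close>

primrec h_seq :: "nat \<Rightarrow> rmat" where
  "h_seq 0 = id_mat"
| "h_seq (Suc n) = (\<lambda>i. next_h (h_seq n i) (cum_w n))"

text \<open>One joint induction, because \<open>lf_mean_next\<close> needs the first two claims for
  the preceding generation.\<close>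

lemma h_seq_props:
  shows "l1pos (h_seq n i)" "scalar_prod (h_seq n i) ones \<le> 1"
    "mat_pow mean_mat n i = lf_mean (h_seq n i) (cum_w n)"
proof (induction n)
  case 0
  { case 1 show ?case using l1pos_unit by (simp add: id_mat_def) }
  { case 2 show ?case using scalar_prod_unit by (simp add: id_mat_def ones_def) }
  { case 3 show ?case by (simp add: lf_mean_def cum_w_def) }
next
  case (Suc n)
  { case 1 show ?case using l1pos_next_h[OF Suc(1,2) l1pos_cum_w] by simp }
  { case 2 show ?case using next_h_total_le[OF Suc(1,2) l1pos_cum_w] by simp }
  { case 3 show ?case
      unfolding mat_pow_Suc_row Suc(3) h_seq.simps cum_w_Suc lf_mean_next[OF Suc(1,2) l1pos_cum_w] .. }
qed

text \<open>Inverts \<open>lf_mean\<close>: summing a row of the power gives the total of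
  \<open>h_seq n i\<close> through \<open>lf_mean_total\<close>, and then \<open>h_seq n i\<close>
  itself by subtraction.\<close>

lemma h_seq_eq:
  "h_seq n i j = mat_pow mean_mat n i j
     - 1 / (1 + scalar_prod (cum_w n) ones) * mat_vec (mat_pow mean_mat n) ones i * cum_w n j"
proof -
  have "scalar_prod (mat_pow mean_mat n i) ones
      = scalar_prod (h_seq n i) ones * (1 + scalar_prod (cum_w n) ones)"
    unfolding h_seq_props(3) by (rule lf_mean_total[OF h_seq_props(1) l1pos_cum_w])
  moreover have "1 + scalar_prod (cum_w n) ones > 0"
    using scalar_prod_nonneg[OF l1pos_cum_w ones_bounds, of n] by simp
  ultimately have "1 / (1 + scalar_prod (cum_w n) ones) * scalar_prod (mat_pow mean_mat n i) ones = scalar_prod (h_seq n i) ones"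
    by (simp add: field_simps)
  moreover have "mat_vec (mat_pow mean_mat n) ones i = scalar_prod (mat_pow mean_mat n i) ones"
    by (simp add: mat_vec_def scalar_prod_def)
  ultimately show ?thesis
    by (simp add: h_seq_props(3) lf_mean_def)
qed

text \<open>Needed to use this vector as a new argument of a generating function. The denominator is
  at least 1, so the fraction lies between 0 and the row sum of \<open>H i\<close>.\<close>

lemma lf_gf_bounds:
  assumes s: "\<forall>j. 0 \<le> s j \<and> s j \<le> 1"
  shows "\<forall>i. 0 \<le> lf_gf (H i) w0 s \<and> lf_gf (H i) w0 s \<le> 1"
proof
  fix i
  let ?D = "1 + scalar_prod w0 ones - scalar_prod w0 s"
  have Hi: "l1pos (H i)" "scalar_prod (H i) ones \<le> 1"
    using H by (auto simp: bdd_rows_def)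
  have D: "1 \<le> ?D"
    using scalar_prod_le[OF w0 s] by simp
  have Hs: "0 \<le> scalar_prod (H i) s" "scalar_prod (H i) s \<le> scalar_prod (H i) ones"
    using scalar_prod_nonneg[OF Hi(1) s] scalar_prod_le[OF Hi(1) s] by auto
  then have "0 \<le> scalar_prod (H i) s / ?D" "scalar_prod (H i) s / ?D \<le> scalar_prod (H i) s"
    using D mult_left_mono[OF D Hs(1)] by (auto simp: field_simps)
  then show "0 \<le> lf_gf (H i) w0 s \<and> lf_gf (H i) w0 s \<le> 1"
    using Hi(2) Hs unfolding lf_gf_def by linarith
qed

end

subsection \<open>The branching recursion\<close>

abbreviation "count_vecs \<equiv> Collect finite_supp"

text \<open>Countability reduces measurability to singletons and permits conditioning on the
  population value by value.\<close>

lemma countable_count_vecs: "countable count_vecs"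
  using countable_nat_product_event_const[of "0::nat" UNIV] by (simp add: finite_supp_def[abs_def])

lemma monomial_eq_prod:
  "\<lbrakk>finite A; {j. x j \<noteq> 0} \<subseteq> A\<rbrakk> \<Longrightarrow> monomial s x = (\<Prod>j\<in>A. s j ^ x j)"
  unfolding monomial_def by (rule prod.mono_neutral_left) auto

lemma finite_supp_sum:
  assumes "finite L" "\<And>l. l \<in> L \<Longrightarrow> finite_supp (d l)"
  shows "finite_supp (\<lambda>j. \<Sum>l\<in>L. d l j)"
  unfolding finite_supp_def
  by (rule finite_subset[of _ "\<Union>l\<in>L. {j. d l j \<noteq> 0}"])
     (use assms in \<open>auto simp: finite_supp_def\<close>)

text \<open>Over a common finite support the exponents add. Combined with independence, this makes
  the generating function of a sum a product.\<close>

lemma monomial_sum: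
  assumes L: "finite L" "\<And>l. l \<in> L \<Longrightarrow> finite_supp (d l)"
  shows "monomial s (\<lambda>j. \<Sum>l\<in>L. d l j) = (\<Prod>l\<in>L. monomial s (d l))"
proof -
  let ?A = "\<Union>l\<in>L. {j. d l j \<noteq> 0}"
  have A: "finite ?A"
    using L by (auto simp: finite_supp_def)
  have "monomial s (\<lambda>j. \<Sum>l\<in>L. d l j) = (\<Prod>j\<in>?A. \<Prod>l\<in>L. s j ^ d l j)"
    using A L by (subst monomial_eq_prod[of ?A]) (auto simp: power_sum)
  also have "\<dots> = (\<Prod>l\<in>L. \<Prod>j\<in>?A. s j ^ d l j)"
    by (rule prod.swap)
  also have "\<dots> = (\<Prod>l\<in>L. monomial s (d l))"
    using A by (intro prod.cong refl monomial_eq_prod[symmetric]) auto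
  finally show ?thesis .
qed

lemma monomial_bounds:
  assumes "\<forall>j. 0 \<le> s j \<and> s j \<le> 1"
  shows "0 \<le> monomial s x" "monomial s x \<le> 1"
  using assms by (auto simp: monomial_def intro!: prod_nonneg prod_le_1 power_le_one)

lemma monomial_unit_vec: "monomial s (unit_vec i) = s i"
  by (subst monomial_eq_prod[of "{i}"]) (auto simp: unit_vec_def)

text \<open>Equality with a fixed vector is a countable conjunction of conditions on
  coordinates.\<close>

lemma measurable_count_vecs:
  assumes X: "X \<in> N \<rightarrow>\<^sub>M count_vec_algebra" and fin: "\<And>\<omega>. \<omega> \<in> space N \<Longrightarrow> finite_supp (X \<omega>)"
  shows "X \<in> N \<rightarrow>\<^sub>M count_space count_vecs"
proof -
  have "X -` {a} \<inter> space N \<in> sets N" for a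
  proof -
    have [measurable]: "(\<lambda>\<omega>. X \<omega> j) \<in> N \<rightarrow>\<^sub>M count_space UNIV" for j
      using measurable_compose[OF X measurable_component_singleton] by simp
    have "X -` {a} \<inter> space N = {\<omega>\<in>space N. \<forall>j. X \<omega> j = a j}"
      by auto
    also have "\<dots> \<in> sets N"
      by measurable
    finally show ?thesis .
  qed
  then show ?thesis
    using fin by (auto simp: measurable_count_space_eq_countable[OF countable_count_vecs])
qed

lemma count_vec_algebra_if_count_vecs:
  "X \<in> N \<rightarrow>\<^sub>M count_space count_vecs \<Longrightarrow> X \<in> N \<rightarrow>\<^sub>M count_vec_algebra"
  using measurable_compose[of X N "count_space count_vecs" "\<lambda>x. x" count_vec_algebra]
  by (simp add: space_PiM)

text \<open>
  Truncation gives every array of vectors finitely supported progeny, so that the population is a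
  measurable function of the whole array and not only on an event of full measure.
\<close>

definition truncate :: "(nat \<Rightarrow> nat) \<Rightarrow> nat \<Rightarrow> nat" where
  "truncate x = (if finite_supp x then x else (\<lambda>_. 0))"

lemma finite_supp_truncate: "finite_supp (truncate x)"
  by (simp add: truncate_def finite_supp_def)

lemma truncate_measurable: "truncate \<in> count_vec_algebra \<rightarrow>\<^sub>M count_space count_vecs"
proof (rule measurable_count_vecs)
  have [measurable]: "(\<lambda>x. x j) \<in> count_vec_algebra \<rightarrow>\<^sub>M count_space UNIV" for j :: nat
    by (rule measurable_component_singleton) simp
  \<comment> \<open>Finite support is rephrased by quantifiers over indices, which are countable and
    hence preserve measurability.\<close>
  have fin: "finite_supp x \<longleftrightarrow> (\<exists>N. \<forall>k\<ge>N. x k = 0)" for x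
    unfolding finite_supp_def finite_nat_set_iff_bounded
    by (metis (mono_tags, lifting) linorder_not_less mem_Collect_eq)
  have *: "truncate x j = (if \<exists>N. \<forall>k\<ge>N. x k = 0 then x j else 0)" for x j
    unfolding truncate_def fin by (rule if_distrib[of "\<lambda>y. y j"])
  have "(\<lambda>x. truncate x j) \<in> count_vec_algebra \<rightarrow>\<^sub>M count_space UNIV" for j
    unfolding * by measurable
  then show "truncate \<in> count_vec_algebra \<rightarrow>\<^sub>M count_vec_algebra"
    by (intro measurable_PiM_single') (auto simp: space_PiM)
qed (rule finite_supp_truncate)

text \<open>The argument \<open>\<eta>\<close> is an offspring array indexed by (generation, type, particle number).\<close>

definition parents :: "(nat \<Rightarrow> nat) \<Rightarrow> (nat \<times> nat) set" where
  "parents x = (SIGMA i:{i. x i \<noteq> 0}. {..<x i})"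

definition progeny :: "nat \<Rightarrow> (nat \<Rightarrow> nat) \<Rightarrow> (nat \<times> nat \<times> nat \<Rightarrow> nat \<Rightarrow> nat) \<Rightarrow> nat \<Rightarrow> nat" where
  "progeny n x \<eta> = (\<lambda>j. \<Sum>l\<in>parents x. truncate (\<eta> (n, l)) j)"

text \<open>Rebuilds the process by a deterministic recursion on arrays, so that generation
  \<open>n\<close> visibly reads only entries of earlier generations.\<close>

primrec population :: "(nat \<Rightarrow> nat) \<Rightarrow> nat \<Rightarrow> (nat \<times> nat \<times> nat \<Rightarrow> nat \<Rightarrow> nat) \<Rightarrow> nat \<Rightarrow> nat" where
  "population z 0 \<eta> = z"
| "population z (Suc n) \<eta> = progeny n (population z n \<eta>) \<eta>"

lemma finite_parents: "finite_supp x \<Longrightarrow> finite (parents x)"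
  by (auto simp: parents_def finite_supp_def)

lemma progeny_measurable:
  assumes "finite_supp x" "{n} \<times> UNIV \<subseteq> J"
  shows "progeny n x \<in> (\<Pi>\<^sub>M l\<in>J. count_vec_algebra) \<rightarrow>\<^sub>M count_space count_vecs"
proof (rule measurable_count_vecs)
  have [measurable]: "(\<lambda>\<eta>. truncate (\<eta> (n, l)) j) \<in> (\<Pi>\<^sub>M l\<in>J. count_vec_algebra) \<rightarrow>\<^sub>M count_space UNIV" for l j
  proof -
    have "(\<lambda>\<eta>. \<eta> (n, l)) \<in> (\<Pi>\<^sub>M l\<in>J. count_vec_algebra) \<rightarrow>\<^sub>M count_vec_algebra"
      using assms(2) by (intro measurable_component_singleton) auto
    from measurable_compose[OF measurable_compose[OF this truncate_measurable], of "\<lambda>x. x j" "count_space UNIV"]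
    show ?thesis by simp
  qed
  show "progeny n x \<in> (\<Pi>\<^sub>M l\<in>J. count_vec_algebra) \<rightarrow>\<^sub>M count_vec_algebra"
    unfolding progeny_def by (rule measurable_PiM_single') (auto simp: space_PiM)
  show "finite_supp (progeny n x \<eta>)" for \<eta>
    unfolding progeny_def using assms(1)
    by (intro finite_supp_sum finite_parents finite_supp_truncate)
qed

text \<open>The population takes countably many values, and \<open>progeny n x\<close> is measurable
  for each fixed value \<open>x\<close>. The set \<open>J\<close> stays open to cover both the full
  array and the generations below \<open>n\<close>.\<close>

lemma population_measurable:
  assumes "finite_supp z" "{..<n} \<times> UNIV \<subseteq> J"
  shows "population z n \<in> (\<Pi>\<^sub>M l\<in>J. count_vec_algebra) \<rightarrow>\<^sub>M count_space count_vecs"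
  using assms(2)
proof (induction n)
  case 0
  then show ?case using assms(1) by simp
next
  case (Suc n)
  then have "{..<n} \<times> UNIV \<subseteq> J" "{n} \<times> UNIV \<subseteq> J"
    by auto
  then have "(\<lambda>\<eta>. progeny n (population z n \<eta>) \<eta>) \<in> (\<Pi>\<^sub>M l\<in>J. count_vec_algebra) \<rightarrow>\<^sub>M count_space count_vecs"
    using Suc.IH
    by (intro measurable_compose_countable'[where f = "progeny n" and g = "population z n",
          OF progeny_measurable _ countable_count_vecs]) auto
  then show ?case by simp
qed

section \<open>Generating functions of successive generations\<close>

context bgw_process
begin

abbreviation offspring :: "'w \<Rightarrow> nat \<times> nat \<times> nat \<Rightarrow> nat \<Rightarrow> nat" where
  "offspring \<omega> \<equiv> \<lambda>(n, i, k). \<xi> n i k \<omega>"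

lemma offspring_alt: "(case l of (n, i, k) \<Rightarrow> \<xi> n i k) \<omega> = offspring \<omega> l"
  by (simp add: case_prod_beta)

text \<open>Offspring vectors have finite support at every point of the space, so truncation leaves
  them unchanged.\<close>

lemma progeny_offspring:
  assumes "\<omega> \<in> space P" "finite_supp x" "{n} \<times> UNIV \<subseteq> J"
  shows "progeny n x (restrict (offspring \<omega>) J) = (\<lambda>j. \<Sum>(i, k)\<in>parents x. \<xi> n i k \<omega> j)"
proof -
  have "truncate (restrict (offspring \<omega>) J (n, l)) = (case l of (i, k) \<Rightarrow> \<xi> n i k \<omega>)" for l
    using assms finite_offspring[OF assms(1)] by (auto simp: truncate_def split: prod.split)
  then show ?thesis
    by (simp add: progeny_def case_prod_beta)
qed

lemma Z_Suc:
  assumes "\<omega> \<in> space P" "finite_supp (Z n \<omega>)"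
  shows "Z (Suc n) \<omega> = (\<lambda>j. \<Sum>(i, k)\<in>parents (Z n \<omega>). \<xi> n i k \<omega> j)"
  using assms unfolding parents_def
  by (subst sum.Sigma[symmetric]) (auto simp: generation finite_supp_def)

lemma finite_supp_Z:
  assumes "\<omega> \<in> space P"
  shows "finite_supp (Z n \<omega>)"
proof (induction n)
  case 0
  show ?case using assms init finite_init by simp
next
  case (Suc n)
  show ?case
    unfolding Z_Suc[OF assms Suc] case_prod_beta
    by (intro finite_supp_sum finite_parents Suc finite_offspring assms)
qed

lemma Z_eq_population:
  assumes "\<omega> \<in> space P" "{..<n} \<times> UNIV \<subseteq> J"
  shows "Z n \<omega> = population z n (restrict (offspring \<omega>) J)"
  using assms(2)
proof (induction n)
  case 0
  show ?case using assms(1) init by simp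
next
  case (Suc n)
  then have "{..<n} \<times> UNIV \<subseteq> J" "{n} \<times> UNIV \<subseteq> J"
    by auto
  with Suc.IH show ?case
    using Z_Suc[of \<omega> n] progeny_offspring[of \<omega> "Z n \<omega>" n J] finite_supp_Z[of \<omega> n] assms(1)
    by (simp del: restrict_apply)
qed

lemma measurable_Z: "Z n \<in> P \<rightarrow>\<^sub>M count_space count_vecs"
proof -
  have "(\<lambda>\<omega>. restrict (offspring \<omega>) UNIV) \<in> P \<rightarrow>\<^sub>M (\<Pi>\<^sub>M l\<in>UNIV. count_vec_algebra)"
    using indep_offspring by (intro measurable_restrict) (auto simp: indep_vars_def offspring_alt[symmetric])
  from measurable_compose[OF this population_measurable[OF finite_init, of n]]
  show ?thesis
    by (subst measurable_cong[OF Z_eq_population[of _ n UNIV]]) auto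
qed

text \<open>For a deterministic population the next generation is a finite sum of independent
  vectors, so each particle of type \<open>i\<close> contributes one factor
  \<open>f i\<close>.\<close>

lemma gf_progeny:
  assumes s: "\<forall>j. 0 \<le> s j \<and> s j \<le> 1" and x: "finite_supp x"
    and f: "\<And>i k. expectation (\<lambda>\<omega>. monomial s (\<xi> n i k \<omega>)) = f i"
  shows "expectation (\<lambda>\<omega>. monomial s (\<lambda>j. \<Sum>(i, k)\<in>parents x. \<xi> n i k \<omega> j)) = monomial f x"
proof -
  let ?X = "\<lambda>l \<omega>. monomial s (truncate (offspring \<omega> l))"
  let ?L = "Pair n ` parents x"
  have fin: "finite (parents x)"
    by (rule finite_parents[OF x])
  have trunc: "truncate (offspring \<omega> l) = offspring \<omega> l" if "\<omega> \<in> space P" for \<omega> l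
    using finite_offspring[OF that] by (auto simp: truncate_def split: prod.split)
  have "(\<lambda>y. monomial s (truncate y)) \<in> borel_measurable count_vec_algebra"
    by (rule measurable_compose[OF truncate_measurable]) simp
  then have "indep_vars (\<lambda>_. borel) (\<lambda>l \<omega>. monomial s (truncate ((case l of (n, i, k) \<Rightarrow> \<xi> n i k) \<omega>))) ?L"
    by (intro indep_vars_compose2[OF indep_vars_subset[OF indep_offspring]]) auto
  then have indep: "indep_vars (\<lambda>_. borel) ?X ?L"
    by (simp add: offspring_alt)
  then have "integrable P (?X l)" if "l \<in> ?L" for l
    using monomial_bounds[OF s] that unfolding indep_vars_def
    by (intro integrable_const_bound[where B = 1]) auto
  then have indep_prod: "expectation (\<lambda>\<omega>. \<Prod>l\<in>?L. ?X l \<omega>) = (\<Prod>l\<in>?L. expectation (?X l))"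
    by (intro indep_vars_lebesgue_integral[OF _ indep]) (use fin in auto)
  have "expectation (\<lambda>\<omega>. monomial s (\<lambda>j. \<Sum>(i, k)\<in>parents x. \<xi> n i k \<omega> j))
      = expectation (\<lambda>\<omega>. \<Prod>l\<in>?L. ?X l \<omega>)"
  proof (rule Bochner_Integration.integral_cong[OF refl])
    fix \<omega> assume \<omega>: "\<omega> \<in> space P"
    have "monomial s (\<lambda>j. \<Sum>(i, k)\<in>parents x. \<xi> n i k \<omega> j)
        = monomial s (\<lambda>j. \<Sum>l\<in>parents x. (case l of (i, k) \<Rightarrow> \<xi> n i k \<omega>) j)"
      by (simp add: case_prod_beta)
    also have "\<dots> = (\<Prod>l\<in>parents x. monomial s (case l of (i, k) \<Rightarrow> \<xi> n i k \<omega>))"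
      using finite_offspring[OF \<omega>] by (intro monomial_sum fin) (auto split: prod.split)
    also have "\<dots> = (\<Prod>l\<in>?L. ?X l \<omega>)"
      using trunc[OF \<omega>] by (simp add: prod.reindex inj_on_def)
    finally show "monomial s (\<lambda>j. \<Sum>(i, k)\<in>parents x. \<xi> n i k \<omega> j) = (\<Prod>l\<in>?L. ?X l \<omega>)" .
  qed
  also note indep_prod
  also have "(\<Prod>l\<in>?L. expectation (?X l)) = (\<Prod>l\<in>?L. f (fst (snd l)))"
  proof (rule prod.cong[OF refl])
    fix l assume "l \<in> ?L"
    moreover have "expectation (?X l) = expectation (\<lambda>\<omega>. monomial s (offspring \<omega> l))"
      by (intro Bochner_Integration.integral_cong refl) (simp add: trunc)
    ultimately show "expectation (?X l) = f (fst (snd l))"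
      using f by auto
  qed
  also have "\<dots> = (\<Prod>(i, k)\<in>parents x. f i)"
    by (simp add: prod.reindex inj_on_def case_prod_beta)
  also have "\<dots> = monomial f x"
    using x unfolding parents_def
    by (subst prod.Sigma[symmetric]) (auto simp: finite_supp_def monomial_def)
  finally show ?thesis .
qed

text \<open>Conditioning on \<open>Z n\<close> takes the form of Fubini's theorem: freeze the
  earlier generations, integrate over the offspring of generation \<open>n\<close> by
  \<open>gf_progeny\<close>, then integrate the rest.\<close>

lemma gf_Z_Suc:
  assumes s: "\<forall>j. 0 \<le> s j \<and> s j \<le> 1"
    and f: "\<And>i k. expectation (\<lambda>\<omega>. monomial s (\<xi> n i k \<omega>)) = f i"
  shows "expectation (\<lambda>\<omega>. monomial s (Z (Suc n) \<omega>)) = expectation (\<lambda>\<omega>. monomial f (Z n \<omega>))"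
proof -
  let ?A = "{..<n} \<times> (UNIV :: (nat \<times> nat) set)" and ?B = "{n} \<times> (UNIV :: (nat \<times> nat) set)"
  let ?MA = "\<Pi>\<^sub>M l\<in>?A. count_vec_algebra" and ?MB = "\<Pi>\<^sub>M l\<in>?B. count_vec_algebra"
  let ?U = "\<lambda>\<omega>. restrict (offspring \<omega>) ?A" and ?V = "\<lambda>\<omega>. restrict (offspring \<omega>) ?B"
  define \<phi> where "\<phi> = (\<lambda>(u, v). monomial s (progeny n (population z n u) v))"
  \<comment> \<open>The two blocks of the offspring array have disjoint index sets, so their joint
    law is a product measure.\<close>
  have "indep_var ?MA ?U ?MB ?V"
    using indep_var_restrict[OF indep_offspring, of ?A ?B] by (auto simp: offspring_alt)
  then have U: "?U \<in> P \<rightarrow>\<^sub>M ?MA" and V: "?V \<in> P \<rightarrow>\<^sub>M ?MB"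
    and joint: "distr P ?MA ?U \<Otimes>\<^sub>M distr P ?MB ?V = distr P (?MA \<Otimes>\<^sub>M ?MB) (\<lambda>\<omega>. (?U \<omega>, ?V \<omega>))"
    by (auto simp: indep_var_distribution_eq)
  interpret U: prob_space "distr P ?MA ?U" by (rule prob_space_distr[OF U])
  interpret V: prob_space "distr P ?MB ?V" by (rule prob_space_distr[OF V])
  interpret UV: pair_prob_space "distr P ?MA ?U" "distr P ?MB ?V" ..
  have pop: "population z n \<in> ?MA \<rightarrow>\<^sub>M count_space count_vecs"
    by (rule population_measurable[OF finite_init]) simp
  have mono: "(\<lambda>v. monomial s (progeny n x v)) \<in> borel_measurable ?MB" if "finite_supp x" for x
    by (rule measurable_compose[OF progeny_measurable]) (auto simp: that)
  \<comment> \<open>Joint measurability follows by splitting over the countably many values of the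
    population, since for a fixed value only the second component varies.\<close>
  have \<phi>: "\<phi> \<in> borel_measurable (?MA \<Otimes>\<^sub>M ?MB)"
    unfolding \<phi>_def case_prod_beta
    by (rule measurable_compose_countable'[OF _ _ countable_count_vecs,
          where f = "\<lambda>x p. monomial s (progeny n x (snd p))" and g = "\<lambda>p. population z n (fst p)"])
       (auto intro: measurable_compose[OF measurable_fst pop] measurable_compose[OF measurable_snd mono])
  have int: "integrable (distr P ?MA ?U \<Otimes>\<^sub>M distr P ?MB ?V) \<phi>"
    using monomial_bounds[OF s] \<phi>
    by (intro UV.integrable_const_bound[where B = 1]) (auto simp: \<phi>_def case_prod_beta)
  have "expectation (\<lambda>\<omega>. monomial s (Z (Suc n) \<omega>)) = expectation (\<lambda>\<omega>. \<phi> (?U \<omega>, ?V \<omega>))"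
  proof (rule Bochner_Integration.integral_cong[OF refl])
    fix \<omega> assume \<omega>: "\<omega> \<in> space P"
    then show "monomial s (Z (Suc n) \<omega>) = \<phi> (?U \<omega>, ?V \<omega>)"
      using Z_Suc[OF \<omega> finite_supp_Z[OF \<omega>]] progeny_offspring[OF \<omega> finite_supp_Z[OF \<omega>], of n ?B n]
        Z_eq_population[OF \<omega>, of n ?A]
      by (simp add: \<phi>_def)
  qed
  also have "\<dots> = (\<integral>p. \<phi> p \<partial>(distr P ?MA ?U \<Otimes>\<^sub>M distr P ?MB ?V))"
    unfolding joint by (rule integral_distr[OF measurable_Pair[OF U V] \<phi>, symmetric])
  also have "\<dots> = (\<integral>u. (\<integral>v. \<phi> (u, v) \<partial>distr P ?MB ?V) \<partial>distr P ?MA ?U)"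
    by (rule UV.integral_fst'[OF int, symmetric])
  also have "\<dots> = (\<integral>u. monomial f (population z n u) \<partial>distr P ?MA ?U)"
  proof (rule Bochner_Integration.integral_cong[OF refl])
    \<comment> \<open>Here \<open>u\<close> is an arbitrary array, not one produced by the process;
      its population has finite support thanks to the truncation.\<close>
    fix u assume "u \<in> space (distr P ?MA ?U)"
    then have x: "finite_supp (population z n u)"
      using measurable_space[OF pop] by auto
    have "(\<integral>v. \<phi> (u, v) \<partial>distr P ?MB ?V)
        = expectation (\<lambda>\<omega>. monomial s (progeny n (population z n u) (?V \<omega>)))"
      unfolding \<phi>_def prod.case by (rule integral_distr[OF V mono[OF x]])
    also have "\<dots> = expectation (\<lambda>\<omega>. monomial s (\<lambda>j. \<Sum>(i, k)\<in>parents (population z n u). \<xi> n i k \<omega> j))"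
      using progeny_offspring x by (intro Bochner_Integration.integral_cong) auto
    also have "\<dots> = monomial f (population z n u)"
      by (rule gf_progeny[OF s x f])
    finally show "(\<integral>v. \<phi> (u, v) \<partial>distr P ?MB ?V) = monomial f (population z n u)" .
  qed
  also have "\<dots> = expectation (\<lambda>\<omega>. monomial f (population z n (?U \<omega>)))"
    by (rule integral_distr[OF U measurable_compose[OF pop]]) simp
  also have "\<dots> = expectation (\<lambda>\<omega>. monomial f (Z n \<omega>))"
    by (intro Bochner_Integration.integral_cong refl arg_cong[where f = "monomial f"] Z_eq_population[symmetric]) auto
  finally show ?thesis .
qed

text \<open>The induction generalises \<open>s\<close>, because the step evaluates the generating
  function of generation \<open>n\<close> at the vector of offspring generating functions.\<close>

lemma gf_Z_eq_lf_gf: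
  assumes "lf_offspring H w0" and z: "z = unit_vec i"
    and gf: "\<And>n i k s. \<forall>j. 0 \<le> s j \<and> s j \<le> 1 \<Longrightarrow>
      expectation (\<lambda>\<omega>. monomial s (\<xi> n i k \<omega>)) = lf_gf (H i) w0 s"
    and s: "\<forall>j. 0 \<le> s j \<and> s j \<le> 1"
  shows "expectation (\<lambda>\<omega>. monomial s (Z n \<omega>))
    = lf_gf (lf_offspring.h_seq H w0 n i) (lf_offspring.cum_w H w0 n) s"
proof -
  interpret lf_offspring H w0 by fact
  show ?thesis
    using s
  proof (induction n arbitrary: s)
    case 0
    have "expectation (\<lambda>\<omega>. monomial s (Z 0 \<omega>)) = expectation (\<lambda>\<omega>. s i)"
      using init z by (intro Bochner_Integration.integral_cong refl) (simp add: monomial_unit_vec)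
    \<comment> \<open>As \<open>cum_w 0\<close> is an empty sum, the denominator is 1 and
      \<open>lf_gf\<close> reduces to the coordinate \<open>s i\<close>.\<close>
    then show ?case
      by (simp add: prob_space lf_gf_def cum_w_def scalar_prod_def[of "\<lambda>_. 0"] id_mat_def scalar_prod_unit ones_def)
  next
    case (Suc n)
    have "expectation (\<lambda>\<omega>. monomial s (Z (Suc n) \<omega>))
        = expectation (\<lambda>\<omega>. monomial (\<lambda>i. lf_gf (H i) w0 s) (Z n \<omega>))"
      by (rule gf_Z_Suc[OF Suc.prems gf[OF Suc.prems]])
    also have "\<dots> = lf_gf (h_seq n i) (cum_w n) (\<lambda>i. lf_gf (H i) w0 s)"
      by (rule Suc.IH[OF lf_gf_bounds[OF Suc.prems]])
    also have "\<dots> = lf_gf (h_seq (Suc n) i) (cum_w (Suc n)) s"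
      unfolding h_seq.simps cum_w_Suc
      by (rule lf_gf_compose[OF h_seq_props(1,2) l1pos_cum_w Suc.prems])
    finally show ?case .
  qed
qed

text \<open>Reduces the claim on the mean matrix to one offspring vector, that of the initial
  particle, which carries number 0.\<close>

lemma Z_1:
  assumes "z = unit_vec i" "\<omega> \<in> space P"
  shows "Z 1 \<omega> = \<xi> 0 i 0 \<omega>"
proof -
  have "parents (unit_vec i) = {(i, 0)}"
    by (auto simp: parents_def unit_vec_def split: if_splits)
  then show ?thesis
    using Z_Suc[OF assms(2) finite_supp_Z[OF assms(2)], of 0] init[OF assms(2)] assms(1) by simp
qed

end

subsection \<open>The mean and the main result\<close>

text \<open>Only coordinate \<open>j\<close> of \<open>ones\<close> is perturbed. Monotone
  convergence yields integrability together with the value, so finiteness of the mean need not be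
  known beforehand.\<close>

lemma has_LF_mean:
  assumes P: "prob_space P" and LF: "has_LF_distribution P X h g m"
  shows "has_bochner_integral P (\<lambda>\<omega>. real (X \<omega> j)) (h j + m * suminf h * g j)"
proof -
  interpret prob_space P by (rule P)
  have m: "0 < m" and fin: "\<And>\<omega>. \<omega> \<in> space P \<Longrightarrow> finite_supp (X \<omega>)"
    and X: "X \<in> P \<rightarrow>\<^sub>M count_vec_algebra"
    and gf: "\<And>s. \<forall>j. 0 \<le> s j \<and> s j \<le> 1 \<Longrightarrow> expectation (\<lambda>\<omega>. monomial s (X \<omega>)) =
          (1 - (\<Sum>j. h j)) + (\<Sum>j. h j * s j) / (1 + m - m * (\<Sum>j. g j * s j))"
    and h: "summable h" and g: "g sums 1" "0 \<le> g j"
    using LF by (auto simp: has_LF_distribution_def subprob_vec_def prob_vec_def)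
  have [measurable]: "(\<lambda>\<omega>. X \<omega> j) \<in> P \<rightarrow>\<^sub>M count_space UNIV"
    using measurable_compose[OF X measurable_component_singleton] by simp
  define u where "u n = inverse (real (Suc n))" for n
  have u: "0 < u n" "u n \<le> 1" for n
    by (simp_all add: u_def field_simps)
  have u0: "u \<longlonglongrightarrow> 0"
    unfolding u_def by (rule LIMSEQ_inverse_real_of_nat)
  \<comment> \<open>The difference quotient of $t \mapsto t^{X_j}$ at $1$ with increment $-u_n$ is a geometric sum
    that increases to $X_j$.\<close>
  define f where "f n \<omega> = (\<Sum>k<X \<omega> j. (1 - u n) ^ k)" for n \<omega>
  define s where "s n i = (if i = j then 1 - u n else 1)" for n i :: nat
  have s01: "\<forall>i. 0 \<le> s n i \<and> s n i \<le> 1" for n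
    using u(1)[of n] u(2)[of n] by (auto simp: s_def less_imp_le)
  have mon: "monomial (s n) x = (1 - u n) ^ x j" if "finite_supp x" for n x
  proof -
    have "monomial (s n) x = (\<Prod>i\<in>insert j {i. x i \<noteq> 0}. s n i ^ x i)"
      using that by (intro monomial_eq_prod) (auto simp: finite_supp_def)
    also have "\<dots> = (\<Prod>i\<in>insert j {i. x i \<noteq> 0}. if i = j then (1 - u n) ^ x j else 1)"
      by (intro prod.cong) (auto simp: s_def)
    also have "\<dots> = (1 - u n) ^ x j"
      using that by (subst prod.delta) (auto simp: finite_supp_def)
    finally show ?thesis .
  qed
  have sum_s: "(\<Sum>i. v i * s n i) = suminf v - v j * u n" if "summable v" for v n
  proof -
    have "(\<lambda>i. v i - (if i = j then v j * u n else 0)) sums (suminf v - v j * u n)"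
      using that by (intro sums_diff sums_single summable_sums)
    moreover have "v i - (if i = j then v j * u n else 0) = v i * s n i" for i
      by (simp add: s_def algebra_simps)
    ultimately show ?thesis by (simp add: sums_iff)
  qed
  have f_eq: "f n \<omega> = (1 - monomial (s n) (X \<omega>)) / u n" if "\<omega> \<in> space P" for n \<omega>
    using u(1)[of n] one_diff_power_eq[of "1 - u n" "X \<omega> j"]
    by (simp add: mon fin that f_def field_simps)
  have pow_int: "integrable P (\<lambda>\<omega>. monomial (s n) (X \<omega>))" for n
  proof (rule integrable_const_bound[where B = 1])
    show "(\<lambda>\<omega>. monomial (s n) (X \<omega>)) \<in> borel_measurable P"
      by (rule measurable_compose[OF measurable_count_vecs[OF X fin]]) auto
  qed (use monomial_bounds[OF s01] in auto)
  then have "integrable P (\<lambda>\<omega>. (1 - monomial (s n) (X \<omega>)) / u n)" for n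
    by simp
  then have int: "integrable P (f n)" for n
    by (subst Bochner_Integration.integrable_cong[OF refl f_eq]) auto
  \<comment> \<open>After subtraction from 1 the terms free of \<open>u n\<close> cancel in the
    numerator, so the division by \<open>u n\<close> leaves an expression that is continuous at
    0.\<close>
  have "expectation (f n) = (h j + m * suminf h * g j) / (1 + m * g j * u n)" for n
  proof -
    have "expectation (f n) = (1 - expectation (\<lambda>\<omega>. monomial (s n) (X \<omega>))) / u n"
      using pow_int[of n]
      by (subst Bochner_Integration.integral_cong[OF refl f_eq]) (auto simp: prob_space)
    also have "expectation (\<lambda>\<omega>. monomial (s n) (X \<omega>))
        = 1 - suminf h + (suminf h - h j * u n) / (1 + m * g j * u n)"
      using g(1) h by (simp add: gf[OF s01] sum_s sums_iff algebra_simps)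
    also have "(1 - \<dots>) / u n = (h j + m * suminf h * g j) / (1 + m * g j * u n)"
    proof -
      have "0 < 1 + m * g j * u n"
        using m g(2) u(1)[of n] by (simp add: add_pos_nonneg)
      then show ?thesis
        using u(1)[of n] by (simp add: divide_simps) (simp add: algebra_simps)
    qed
    finally show ?thesis .
  qed
  moreover have "(\<lambda>n. (h j + m * suminf h * g j) / (1 + m * g j * u n))
      \<longlonglongrightarrow> (h j + m * suminf h * g j) / (1 + m * g j * 0)"
    by (intro tendsto_intros u0) simp
  ultimately have lim: "(\<lambda>n. expectation (f n)) \<longlonglongrightarrow> h j + m * suminf h * g j"
    by simp
  show ?thesis
  proof (rule has_bochner_integral_monotone_convergence[OF int _ _ lim])
    have "u n \<le> u k" if "k \<le> n" for k n
      using that by (simp add: u_def)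
    then show "AE \<omega> in P. mono (\<lambda>n. f n \<omega>)"
      using u(2) unfolding f_def by (intro AE_I2 monoI sum_mono power_mono) auto
    have "(\<lambda>n. f n \<omega>) \<longlonglongrightarrow> (\<Sum>k<X \<omega> j. (1 - 0) ^ k)" for \<omega>
      unfolding f_def by (intro tendsto_intros u0)
    then show "AE \<omega> in P. (\<lambda>n. f n \<omega>) \<longlonglongrightarrow> real (X \<omega> j)"
      by simp
  qed measurable
qed

text \<open>Each starting type has its own probability space. The witnesses are built from
  \<open>H\<close>, \<open>g\<close> and \<open>m\<close> alone, hence serve all these processes at
  once.\<close>

theorem theorem3:
  fixes H :: rmat and g :: rvec and m :: real
    and P :: "nat \<Rightarrow> 'w measure"
    and \<xi> :: "nat \<Rightarrow> nat \<Rightarrow> nat \<Rightarrow> nat \<Rightarrow> 'w \<Rightarrow> nat \<Rightarrow> nat"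
    and Z :: "nat \<Rightarrow> nat \<Rightarrow> 'w \<Rightarrow> nat \<Rightarrow> nat"
    and M :: rmat
  assumes "substochastic H" and "prob_vec g" and "0 < m"
    and "\<And>i. lf_bgw_process (P i) (unit_vec i) (\<xi> i) (Z i) H g m"
    and "M = lf_mean_matrix H g m"
  shows "(\<forall>i j. has_bochner_integral (P i) (\<lambda>\<omega>. real (Z i 1 \<omega> j)) (M i j)) \<and>
    (\<forall>n\<ge>1. \<exists>Hn gn mn.
       substochastic Hn \<and> prob_vec gn \<and> 0 < mn \<and>
       (\<forall>i. has_LF_distribution (P i) (Z i n) (Hn i) gn mn) \<and>
       mn = m * (\<Sum>k<n. scalar_prod (vec_mat g (mat_pow M k)) ones) \<and>
       (\<forall>j. mn * gn j = m * vec_mat g (\<lambda>i j. \<Sum>k<n. mat_pow M k i j) j) \<and>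
       (\<forall>i j. Hn i j = mat_pow M n i j
          - mn / (1 + mn) * mat_vec (mat_pow M n) ones i * gn j))"
proof (intro conjI allI impI)
  interpret L: lf_bgw_process "P i" "unit_vec i" "\<xi> i" "Z i" H g m for i
    by (rule assms(4))
  have H: "l1pos (H i)" "scalar_prod (H i) ones \<le> 1" for i
    using assms(1) by (auto simp: substochastic_def subprob_vec_iff_l1pos)
  have g: "l1pos g" "scalar_prod g ones = 1"
    using assms(2) by (auto simp: prob_vec_iff_l1pos)
  define w0 where "w0 = (\<lambda>j. m * g j)"
  have w0: "l1pos w0" "scalar_prod w0 ones = m"
    using l1pos_scaled[OF g(1)] scalar_prod_scaled[OF g(1) ones_bounds] g(2) assms(3)
    by (auto simp: w0_def)
  interpret lf_offspring H w0
    by unfold_locales (auto simp: bdd_rows_def H w0)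
  have M: "M = mean_mat"
    unfolding assms(5) lf_mean_matrix_def mean_mat_def lf_mean_def mat_vec_def scalar_prod_def
    by (simp add: w0_def mult_ac)

  show "has_bochner_integral (P i) (\<lambda>\<omega>. real (Z i 1 \<omega> j)) (M i j)" for i j
  proof -
    have "has_bochner_integral (P i) (\<lambda>\<omega>. real (\<xi> i 0 i 0 \<omega> j)) (H i j + m * suminf (H i) * g j)"
      by (rule has_LF_mean[OF L.prob_space_axioms L.offspring_LF])
    moreover have "H i j + m * suminf (H i) * g j = M i j"
      unfolding M mean_mat_def lf_mean_def scalar_prod_ones by (simp add: w0_def)
    ultimately show ?thesis
      by (subst has_bochner_integral_cong[OF refl _ refl]) (auto simp del: One_nat_def simp: L.Z_1)
  qed

  fix n :: nat
  assume n: "n \<ge> 1"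
  \<comment> \<open>This is \<open>cum_w n\<close>; its total mass and its normalisation provide the
    witnesses \<open>mn\<close> and \<open>gn\<close>.\<close>
  define w where "w = (\<lambda>j. \<Sum>k<n. vec_mat w0 (mat_pow M k) j)"
  define mn where "mn = scalar_prod w ones"
  define gn where "gn = (\<lambda>j. w j / mn)"
  have vec_w0: "vec_mat w0 (mat_pow M k) = (\<lambda>j. m * vec_mat g (mat_pow M k) j)" for k
    unfolding w0_def M using vec_mat_scaled[OF bdd_rows_mean_mat_pow g(1)] unfolding w0_def .
  have l1g: "l1pos (vec_mat g (mat_pow M k))" for k
    unfolding M by (rule l1pos_vec_mat[OF bdd_rows_mean_mat_pow g(1)])
  have w: "l1pos w"
    unfolding w_def M cum_w_def[symmetric] by (rule l1pos_cum_w)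
  have mn_eq: "mn = m * (\<Sum>k<n. scalar_prod (vec_mat g (mat_pow M k)) ones)"
  proof -
    have "mn = (\<Sum>k<n. scalar_prod (vec_mat w0 (mat_pow M k)) ones)"
      unfolding mn_def w_def using l1pos_vec_mat[OF bdd_rows_mean_mat_pow w0(1)] unfolding M
      by (intro scalar_prod_sum_left) auto
    then show ?thesis
      by (simp add: vec_w0 scalar_prod_scaled[OF l1g ones_bounds] sum_distrib_left)
  qed
  \<comment> \<open>The term for exponent 0, present because \<open>n \<ge> 1\<close>, equals the
    mass 1 of \<open>g\<close>. Hence \<open>mn\<close> is at least \<open>m\<close>, and dividing
    by it is legitimate.\<close>
  have "scalar_prod (vec_mat g (mat_pow M 0)) ones
      \<le> (\<Sum>k<n. scalar_prod (vec_mat g (mat_pow M k)) ones)"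
    using n scalar_prod_nonneg[OF l1g ones_bounds] by (intro member_le_sum) auto
  then have mn: "0 < mn"
    using assms(3) g(2) by (simp add: mn_eq vec_mat_id)
  have w_eq: "w = (\<lambda>j. mn * gn j)"
    using mn by (simp add: gn_def)
  have gn: "prob_vec gn"
    using l1pos_scaled[OF w, of "1 / mn"] scalar_prod_scaled[OF w ones_bounds, of "1 / mn"] mn
    by (simp add: prob_vec_iff_l1pos gn_def mn_def[symmetric])
  have Hn: "subprob_vec (h_seq n i)" for i
    using h_seq_props by (simp add: subprob_vec_iff_l1pos)
  have "has_LF_distribution (P i) (Z i n) (h_seq n i) gn mn" for i
    unfolding has_LF_distribution_def
  proof (intro conjI Hn gn mn ballI allI impI)
    show "Z i n \<in> P i \<rightarrow>\<^sub>M count_vec_algebra"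
      by (rule count_vec_algebra_if_count_vecs[OF L.measurable_Z])
    show "finite_supp (Z i n \<omega>)" if "\<omega> \<in> space (P i)" for \<omega>
      by (rule L.finite_supp_Z[OF that])
    fix s :: rvec
    assume s: "\<forall>j. 0 \<le> s j \<and> s j \<le> 1"
    have gf: "(\<integral>\<omega>. monomial s (\<xi> i n j k \<omega>) \<partial>P i) = lf_gf (H j) w0 s"
      if "\<forall>j. 0 \<le> s j \<and> s j \<le> 1" for n j k s
      using L.offspring_LF[of i n j k] that
      unfolding w0_def lf_gf_scaled[OF assms(2) that] has_LF_distribution_def by blast
    have "(\<integral>\<omega>. monomial s (Z i n \<omega>) \<partial>P i) = lf_gf (h_seq n i) w s"
      unfolding w_def M cum_w_def[symmetric] by (rule L.gf_Z_eq_lf_gf[OF lf_offspring_axioms refl gf s])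
    then show "(\<integral>\<omega>. monomial s (Z i n \<omega>) \<partial>P i) = 1 - (\<Sum>j. h_seq n i j)
        + (\<Sum>j. h_seq n i j * s j) / (1 + mn - mn * (\<Sum>j. gn j * s j))"
      unfolding w_eq lf_gf_scaled[OF gn s] .
  qed
  moreover have "mn * gn j = m * vec_mat g (\<lambda>i j. \<Sum>k<n. mat_pow M k i j) j" for j
  proof -
    have "mn * gn j = w j"
      by (simp add: w_eq)
    also have "\<dots> = m * (\<Sum>k<n. vec_mat g (mat_pow M k) j)"
      by (simp add: w_def vec_w0 sum_distrib_left)
    also have "(\<Sum>k<n. vec_mat g (mat_pow M k) j) = vec_mat g (\<lambda>i j. \<Sum>k<n. mat_pow M k i j) j"
      unfolding M by (rule vec_mat_sum[OF bdd_rows_mean_mat_pow g(1), symmetric])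
    finally show ?thesis .
  qed
  \<comment> \<open>Replacing \<open>w j\<close> by \<open>mn * gn j\<close> turns the factor
    \<open>1 / (1 + mn)\<close> of \<open>h_seq_eq\<close> into
    \<open>mn / (1 + mn)\<close>.\<close>
  moreover have "h_seq n i j = mat_pow M n i j
      - mn / (1 + mn) * mat_vec (mat_pow M n) ones i * gn j" for i j
    using h_seq_eq[of n i j, folded M, folded w_def[folded M, unfolded M, folded cum_w_def], folded mn_def] mn by (simp add: gn_def)
  ultimately show "\<exists>Hn gn mn.
       substochastic Hn \<and> prob_vec gn \<and> 0 < mn \<and>
       (\<forall>i. has_LF_distribution (P i) (Z i n) (Hn i) gn mn) \<and>
       mn = m * (\<Sum>k<n. scalar_prod (vec_mat g (mat_pow M k)) ones) \<and>
       (\<forall>j. mn * gn j = m * vec_mat g (\<lambda>i j. \<Sum>k<n. mat_pow M k i j) j) \<and>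
       (\<forall>i j. Hn i j = mat_pow M n i j
          - mn / (1 + mn) * mat_vec (mat_pow M n) ones i * gn j)"
    using Hn gn mn mn_eq unfolding substochastic_def
    by (intro exI[of _ "h_seq n"] exI[of _ gn] exI[of _ mn]) blast
qed

end
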